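(* Let $X$ be a symplectic manifold on which a Lie group $G$ acts in a Hamiltonian way with moment map $\Phi:X\to\mathfrak g^*$ that intersects $\{0\}\subset\mathfrak g^*$ cleanly, let $Y=\Phi^{-1}(0)/G$ be the reduced space (assumed to be a manifold, with its reduced symplectic form), and let $\rho:\Phi^{-1}(0)\to Y$ be the projection. Let $f,g:X\to\mathbf{R}$ be smooth $G$-invariant functions on $X$ and $f',g':Y\to\mathbf{R}$ the induced functions, i.e. $f'\circ\rho=f|_{\Phi^{-1}(0)}$ and $g'\circ\rho=g|_{\Phi^{-1}(0)}$. Then $$\{f',g'\}\circ\rho=\{f,g\}\big|_{\Phi^{-1}(0)}.$$ In particular, Poisson-commuting $G$-invariant functions descend to Poisson-commuting functions.
   Context: $\mathfrak g$ is the Lie algebra of $G$; the moment map is $G$-equivariant for the coadjoint action. $\Phi$ intersects $\{0\}$ cleanly if $\Phi^{-1}(0)$ is a submanifold of $X$ and $T_x(\Phi^{-1}(0))=\ker d\Phi_x$ for each $x\in\Phi^{-1}(0)$. The reduced symplectic form $\omega_r$ on $Y$ (with $\rho$ a submersion) is characterized by $\rho^*\omega_r=\omega|_{\Phi^{-1}(0)}$, where $\omega$ is the symplectic form of $X$. $\{\,,\}$ denotes the Poisson bracket of the respective symplectic manifold, with the same sign convention on $X$ and $Y$. *)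

theory Defs
  imports "HOL-Analysis.Analysis" "HOL-Algebra.Group_Action"
begin

section \<open>Smooth functions on relatively open subsets of linear subspaces\<close>

text \<open>
  Charts take values in a linear subspace \<open>V\<close> of a Euclidean space rather than in the whole space,
  since a type of class \<open>euclidean_space\<close> has positive dimension, whereas discrete groups and
  zero-dimensional reduced spaces should be allowed.  If \<open>S\<close> is relatively open in \<open>V\<close>, then a
  derivative within \<open>S\<close> at a point of \<open>S\<close> is uniquely determined on \<open>V\<close>.
\<close>

primrec Ck_on ::
  "nat \<Rightarrow> 'e::euclidean_space set \<Rightarrow> 'e set \<Rightarrow> ('e \<Rightarrow> 'f::real_normed_vector) \<Rightarrow> bool" where
  "Ck_on 0 V S f \<longleftrightarrow> continuous_on S f"
| "Ck_on (Suc k) V S f \<longleftrightarrow>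
     (\<exists>f'. (\<forall>p\<in>S. (f has_derivative f' p) (at p within S)) \<and>
           (\<forall>v\<in>V. Ck_on k V S (\<lambda>p. f' p v)))"

definition smooth_on ::
  "'e::euclidean_space set \<Rightarrow> 'e set \<Rightarrow> ('e \<Rightarrow> 'f::real_normed_vector) \<Rightarrow> bool" where
  "smooth_on V S f \<longleftrightarrow> (\<forall>k. Ck_on k V S f)"


section \<open>Smooth manifolds\<close>

datatype ('a, 'e) chart = Chart (cdom: "'a set") (cmap: "'a \<Rightarrow> 'e") (cmodel: "'e set")

datatype ('a, 'e) manifold = Manifold (mtop: "'a topology") (atlas: "('a, 'e) chart set")

definition pts :: "('a, 'e) manifold \<Rightarrow> 'a set" where
  "pts M = topspace (mtop M)"

definition cinv :: "('a, 'e) chart \<Rightarrow> 'e \<Rightarrow> 'a" where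
  "cinv c = inv_into (cdom c) (cmap c)"

definition is_chart :: "'a topology \<Rightarrow> ('a, 'e::euclidean_space) chart \<Rightarrow> bool" where
  "is_chart T c \<longleftrightarrow>
     openin T (cdom c) \<and> subspace (cmodel c) \<and>
     openin (top_of_set (cmodel c)) (cmap c ` cdom c) \<and>
     homeomorphic_map (subtopology T (cdom c)) (top_of_set (cmap c ` cdom c)) (cmap c)"

text \<open>
  The atlas need not be maximal.  The model space is attached to the chart, so that different
  components may have different dimensions.
\<close>

definition smooth_manifold :: "('a, 'e::euclidean_space) manifold \<Rightarrow> bool" where
  "smooth_manifold M \<longleftrightarrow>
     Hausdorff_space (mtop M) \<and> second_countable (mtop M) \<and>
     (\<forall>c\<in>atlas M. is_chart (mtop M) c) \<and>
     (\<Union>c\<in>atlas M. cdom c) = pts M \<and>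
     (\<forall>c\<in>atlas M. \<forall>d\<in>atlas M.
        smooth_on (cmodel c) (cmap c ` (cdom c \<inter> cdom d)) (\<lambda>p. cmap d (cinv c p)))"

definition smooth_map ::
  "('a, 'e::euclidean_space) manifold \<Rightarrow> ('b, 'f::euclidean_space) manifold \<Rightarrow> ('a \<Rightarrow> 'b) \<Rightarrow> bool"
where
  "smooth_map M N f \<longleftrightarrow>
     continuous_map (mtop M) (mtop N) f \<and>
     (\<forall>c\<in>atlas M. \<forall>d\<in>atlas N.
        smooth_on (cmodel c) (cmap c ` (cdom c \<inter> f -` cdom d)) (\<lambda>p. cmap d (f (cinv c p))))"

definition real_manifold :: "(real, real) manifold" where
  "real_manifold = Manifold euclidean {Chart UNIV (\<lambda>x. x) UNIV}"

definition prod_chart ::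
  "('a, 'e) chart \<Rightarrow> ('b, 'f) chart \<Rightarrow> ('a \<times> 'b, 'e \<times> 'f) chart" where
  "prod_chart c d =
     Chart (cdom c \<times> cdom d) (map_prod (cmap c) (cmap d)) (cmodel c \<times> cmodel d)"

definition prod_manifold ::
  "('a, 'e) manifold \<Rightarrow> ('b, 'f) manifold \<Rightarrow> ('a \<times> 'b, 'e \<times> 'f) manifold" where
  "prod_manifold M N =
     Manifold (prod_topology (mtop M) (mtop N)) {prod_chart c d | c d. c \<in> atlas M \<and> d \<in> atlas N}"


section \<open>Tangent spaces and tangent maps\<close>

text \<open>
  A tangent vector at \<open>x\<close> is represented by its coordinate vector in a chart around \<open>x\<close> that is
  chosen once and for all; the tangent space is thus the model space of that chart.  Coordinate
  vectors with respect to another chart are translated by \<open>coord_vec\<close>.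
\<close>

definition chart_at :: "('a, 'e) manifold \<Rightarrow> 'a \<Rightarrow> ('a, 'e) chart" where
  "chart_at M x = (SOME c. c \<in> atlas M \<and> x \<in> cdom c)"

definition tangent_space :: "('a, 'e) manifold \<Rightarrow> 'a \<Rightarrow> 'e set" where
  "tangent_space M x = cmodel (chart_at M x)"

definition chart_deriv ::
  "('a, 'e::euclidean_space) chart \<Rightarrow> ('b, 'f::euclidean_space) chart \<Rightarrow> ('a \<Rightarrow> 'b) \<Rightarrow> 'a \<Rightarrow> 'e \<Rightarrow> 'f"
where
  "chart_deriv c d f x =
     frechet_derivative (\<lambda>p. cmap d (f (cinv c p))) (at (cmap c x) within cmap c ` cdom c)"

definition tangent_map ::
  "('a, 'e::euclidean_space) manifold \<Rightarrow> ('b, 'f::euclidean_space) manifold \<Rightarrow> ('a \<Rightarrow> 'b) \<Rightarrow>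
   'a \<Rightarrow> 'e \<Rightarrow> 'f"
where
  "tangent_map M N f x = chart_deriv (chart_at M x) (chart_at N (f x)) f x"

text \<open>The tangent vector at \<open>x\<close> whose coordinate vector in the chart \<open>c\<close> is \<open>u\<close>.\<close>

definition coord_vec ::
  "('a, 'e::euclidean_space) manifold \<Rightarrow> ('a, 'e) chart \<Rightarrow> 'a \<Rightarrow> 'e \<Rightarrow> 'e" where
  "coord_vec M c x u = chart_deriv c (chart_at M x) (\<lambda>y. y) x u"

abbreviation differential ::
  "('a, 'e::euclidean_space) manifold \<Rightarrow> ('a \<Rightarrow> real) \<Rightarrow> 'a \<Rightarrow> 'e \<Rightarrow> real" where
  "differential M f \<equiv> tangent_map M real_manifold f"

definition embedded_submanifold ::
  "('a, 'e::euclidean_space) manifold \<Rightarrow> ('a, 'f::euclidean_space) manifold \<Rightarrow> bool" where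
  "embedded_submanifold Z M \<longleftrightarrow>
     smooth_manifold Z \<and> pts Z \<subseteq> pts M \<and> mtop Z = subtopology (mtop M) (pts Z) \<and>
     smooth_map Z M (\<lambda>x. x) \<and>
     (\<forall>x\<in>pts Z. inj_on (tangent_map Z M (\<lambda>x. x) x) (tangent_space Z x))"

definition submersion ::
  "('a, 'e::euclidean_space) manifold \<Rightarrow> ('b, 'f::euclidean_space) manifold \<Rightarrow> ('a \<Rightarrow> 'b) \<Rightarrow> bool"
where
  "submersion M N f \<longleftrightarrow>
     smooth_map M N f \<and>
     (\<forall>x\<in>pts M. tangent_map M N f x ` tangent_space M x = tangent_space N (f x))"


section \<open>Symplectic manifolds and Poisson brackets\<close>

definition linear_functional_on :: "'e::real_vector set \<Rightarrow> ('e \<Rightarrow> real) \<Rightarrow> bool" where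
  "linear_functional_on V l \<longleftrightarrow>
     (\<forall>u\<in>V. \<forall>v\<in>V. l (u + v) = l u + l v) \<and> (\<forall>a. \<forall>u\<in>V. l (a *\<^sub>R u) = a * l u)"

text \<open>
  A two-form assigns to each point \<open>x\<close> a function of two arguments of which only the restriction
  to the tangent space at \<open>x\<close> matters.
\<close>

type_synonym ('a, 'e) two_form = "'a \<Rightarrow> 'e \<Rightarrow> 'e \<Rightarrow> real"

definition local_form ::
  "('a, 'e::euclidean_space) manifold \<Rightarrow> ('a, 'e) two_form \<Rightarrow> ('a, 'e) chart \<Rightarrow> 'e \<Rightarrow> 'e \<Rightarrow> 'e \<Rightarrow> real"
where
  "local_form M \<omega> c p u v =
     \<omega> (cinv c p) (coord_vec M c (cinv c p) u) (coord_vec M c (cinv c p) v)"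

definition smooth_two_form ::
  "('a, 'e::euclidean_space) manifold \<Rightarrow> ('a, 'e) two_form \<Rightarrow> bool" where
  "smooth_two_form M \<omega> \<longleftrightarrow>
     (\<forall>x\<in>pts M. \<forall>u\<in>tangent_space M x.
        linear_functional_on (tangent_space M x) (\<lambda>v. \<omega> x u v) \<and>
        linear_functional_on (tangent_space M x) (\<lambda>v. \<omega> x v u) \<and>
        \<omega> x u u = 0) \<and>
     (\<forall>c\<in>atlas M. \<forall>u\<in>cmodel c. \<forall>v\<in>cmodel c.
        smooth_on (cmodel c) (cmap c ` cdom c) (\<lambda>p. local_form M \<omega> c p u v))"

definition local_deriv ::
  "('a, 'e::euclidean_space) chart \<Rightarrow> ('e \<Rightarrow> real) \<Rightarrow> 'e \<Rightarrow> 'e \<Rightarrow> real" where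
  "local_deriv c h p = frechet_derivative h (at p within cmap c ` cdom c)"

text \<open>
  This is \<open>d\<omega>(u,v,w) = 0\<close> on constant (hence commuting) coordinate vector fields in each chart.
\<close>

definition closed_two_form ::
  "('a, 'e::euclidean_space) manifold \<Rightarrow> ('a, 'e) two_form \<Rightarrow> bool" where
  "closed_two_form M \<omega> \<longleftrightarrow>
     (\<forall>c\<in>atlas M. \<forall>p\<in>cmap c ` cdom c. \<forall>u\<in>cmodel c. \<forall>v\<in>cmodel c. \<forall>w\<in>cmodel c.
        local_deriv c (\<lambda>q. local_form M \<omega> c q v w) p u
        + local_deriv c (\<lambda>q. local_form M \<omega> c q w u) p v
        + local_deriv c (\<lambda>q. local_form M \<omega> c q u v) p w = 0)"

definition nondegenerate_two_form ::
  "('a, 'e) manifold \<Rightarrow> ('a, 'e::zero) two_form \<Rightarrow> bool" where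
  "nondegenerate_two_form M \<omega> \<longleftrightarrow>
     (\<forall>x\<in>pts M. \<forall>u\<in>tangent_space M x. (\<forall>v\<in>tangent_space M x. \<omega> x u v = 0) \<longrightarrow> u = 0)"

definition symplectic_manifold ::
  "('a, 'e::euclidean_space) manifold \<Rightarrow> ('a, 'e) two_form \<Rightarrow> bool" where
  "symplectic_manifold M \<omega> \<longleftrightarrow>
     smooth_manifold M \<and> smooth_two_form M \<omega> \<and> closed_two_form M \<omega> \<and> nondegenerate_two_form M \<omega>"

text \<open>Sign conventions: \<open>\<omega>(H\<^sub>f, \<cdot>) = df\<close> and \<open>{f, g} = \<omega>(H\<^sub>f, H\<^sub>g)\<close>.\<close>

definition ham_vec ::
  "('a, 'e::euclidean_space) manifold \<Rightarrow> ('a, 'e) two_form \<Rightarrow> ('a \<Rightarrow> real) \<Rightarrow> 'a \<Rightarrow> 'e" where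
  "ham_vec M \<omega> f x =
     (THE v. v \<in> tangent_space M x \<and> (\<forall>w\<in>tangent_space M x. \<omega> x v w = differential M f x w))"

definition poisson ::
  "('a, 'e::euclidean_space) manifold \<Rightarrow> ('a, 'e) two_form \<Rightarrow> ('a \<Rightarrow> real) \<Rightarrow> ('a \<Rightarrow> real) \<Rightarrow> 'a \<Rightarrow> real"
where
  "poisson M \<omega> f g x = \<omega> x (ham_vec M \<omega> f x) (ham_vec M \<omega> g x)"


section \<open>Lie groups and Hamiltonian actions\<close>

definition lie_group :: "'g monoid \<Rightarrow> ('g, 'l::euclidean_space) manifold \<Rightarrow> bool" where
  "lie_group G GM \<longleftrightarrow>
     group G \<and> smooth_manifold GM \<and> carrier G = pts GM \<and>
     smooth_map (prod_manifold GM GM) GM (\<lambda>(a, b). a \<otimes>\<^bsub>G\<^esub> b) \<and>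
     smooth_map GM GM (\<lambda>a. inv\<^bsub>G\<^esub> a)"

text \<open>Of the Lie algebra only the underlying vector space and the adjoint action are needed.\<close>

definition lie_algebra :: "'g monoid \<Rightarrow> ('g, 'l) manifold \<Rightarrow> 'l set" where
  "lie_algebra G GM = tangent_space GM \<one>\<^bsub>G\<^esub>"

definition adjoint :: "'g monoid \<Rightarrow> ('g, 'l::euclidean_space) manifold \<Rightarrow> 'g \<Rightarrow> 'l \<Rightarrow> 'l" where
  "adjoint G GM a = tangent_map GM GM (\<lambda>b. a \<otimes>\<^bsub>G\<^esub> b \<otimes>\<^bsub>G\<^esub> inv\<^bsub>G\<^esub> a) \<one>\<^bsub>G\<^esub>"

text \<open>Functionals on \<open>V\<close> are extended by zero outside \<open>V\<close>, so that equality is equality on \<open>V\<close>.\<close>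

definition dual_space :: "'l::real_vector set \<Rightarrow> ('l \<Rightarrow> real) set" where
  "dual_space V = {l. linear_functional_on V l \<and> (\<forall>v. v \<notin> V \<longrightarrow> l v = 0)}"

definition coadjoint ::
  "'g monoid \<Rightarrow> ('g, 'l::euclidean_space) manifold \<Rightarrow> 'g \<Rightarrow> ('l \<Rightarrow> real) \<Rightarrow> ('l \<Rightarrow> real)" where
  "coadjoint G GM a l =
     (\<lambda>\<xi>. if \<xi> \<in> lie_algebra G GM then l (adjoint G GM (inv\<^bsub>G\<^esub> a) \<xi>) else 0)"

text \<open>
  Smoothness and derivative of a map into the finite-dimensional vector space \<open>dual_space V\<close> are
  taken componentwise.
\<close>

definition smooth_dual_map ::
  "('a, 'e::euclidean_space) manifold \<Rightarrow> 'l::real_vector set \<Rightarrow> ('a \<Rightarrow> 'l \<Rightarrow> real) \<Rightarrow> bool" where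
  "smooth_dual_map M V \<Phi> \<longleftrightarrow>
     (\<forall>x\<in>pts M. \<Phi> x \<in> dual_space V) \<and>
     (\<forall>\<xi>\<in>V. smooth_map M real_manifold (\<lambda>x. \<Phi> x \<xi>))"

definition dual_deriv ::
  "('a, 'e::euclidean_space) manifold \<Rightarrow> 'l set \<Rightarrow> ('a \<Rightarrow> 'l \<Rightarrow> real) \<Rightarrow> 'a \<Rightarrow> 'e \<Rightarrow> ('l \<Rightarrow> real)"
where
  "dual_deriv M V \<Phi> x v = (\<lambda>\<xi>. if \<xi> \<in> V then differential M (\<lambda>y. \<Phi> y \<xi>) x v else 0)"

definition smooth_action ::
  "'g monoid \<Rightarrow> ('g, 'l::euclidean_space) manifold \<Rightarrow> ('a, 'e::euclidean_space) manifold \<Rightarrow>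
   ('g \<Rightarrow> 'a \<Rightarrow> 'a) \<Rightarrow> bool"
where
  "smooth_action G GM X act \<longleftrightarrow>
     group_action G (pts X) act \<and> smooth_map (prod_manifold GM X) X (\<lambda>(a, x). act a x)"

text \<open>
  The fundamental vector field of \<open>\<xi>\<close>, as the derivative of the orbit map at the identity; this is
  the derivative of \<open>exp (t \<xi>) x\<close> at \<open>t = 0\<close>.
\<close>

definition fund_vec ::
  "'g monoid \<Rightarrow> ('g, 'l::euclidean_space) manifold \<Rightarrow> ('a, 'e::euclidean_space) manifold \<Rightarrow>
   ('g \<Rightarrow> 'a \<Rightarrow> 'a) \<Rightarrow> 'l \<Rightarrow> 'a \<Rightarrow> 'e"
where
  "fund_vec G GM X act \<xi> x = tangent_map GM X (\<lambda>a. act a x) \<one>\<^bsub>G\<^esub> \<xi>"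

definition hamiltonian_action ::
  "'g monoid \<Rightarrow> ('g, 'l::euclidean_space) manifold \<Rightarrow> ('a, 'e::euclidean_space) manifold \<Rightarrow>
   ('a, 'e) two_form \<Rightarrow> ('g \<Rightarrow> 'a \<Rightarrow> 'a) \<Rightarrow> ('a \<Rightarrow> 'l \<Rightarrow> real) \<Rightarrow> bool"
where
  "hamiltonian_action G GM X \<omega> act \<Phi> \<longleftrightarrow>
     smooth_action G GM X act \<and>
     (\<forall>a\<in>carrier G. \<forall>x\<in>pts X. \<forall>u\<in>tangent_space X x. \<forall>v\<in>tangent_space X x.
        \<omega> (act a x) (tangent_map X X (act a) x u) (tangent_map X X (act a) x v) = \<omega> x u v) \<and>
     smooth_dual_map X (lie_algebra G GM) \<Phi> \<and>
     (\<forall>\<xi>\<in>lie_algebra G GM. \<forall>x\<in>pts X. \<forall>v\<in>tangent_space X x.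
        differential X (\<lambda>y. \<Phi> y \<xi>) x v = \<omega> x (fund_vec G GM X act \<xi> x) v) \<and>
     (\<forall>a\<in>carrier G. \<forall>x\<in>pts X. \<Phi> (act a x) = coadjoint G GM a (\<Phi> x))"


section \<open>Clean intersection and reduction\<close>

definition zero_level :: "('a, 'e) manifold \<Rightarrow> ('a \<Rightarrow> 'l \<Rightarrow> real) \<Rightarrow> 'a set" where
  "zero_level X \<Phi> = {x \<in> pts X. \<Phi> x = (\<lambda>_. 0)}"

text \<open>
  \<open>Z\<close> is the zero level with its submanifold structure; the tangent space of \<open>Z\<close> is regarded as a
  subspace of that of \<open>X\<close> by means of the tangent map of the inclusion.
\<close>

definition clean_zero_level ::
  "('a, 'e::euclidean_space) manifold \<Rightarrow> 'l set \<Rightarrow> ('a \<Rightarrow> 'l \<Rightarrow> real) \<Rightarrow>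
   ('a, 'z::euclidean_space) manifold \<Rightarrow> bool"
where
  "clean_zero_level X V \<Phi> Z \<longleftrightarrow>
     pts Z = zero_level X \<Phi> \<and> embedded_submanifold Z X \<and>
     (\<forall>x\<in>pts Z. tangent_map Z X (\<lambda>y. y) x ` tangent_space Z x =
                {v \<in> tangent_space X x. dual_deriv X V \<Phi> x v = (\<lambda>_. 0)})"

text \<open>The points of \<open>Y\<close> are the orbits in \<open>Z\<close>, and \<open>orbit G act\<close> is the projection.\<close>

definition reduced_space ::
  "'g monoid \<Rightarrow> ('a, 'e::euclidean_space) manifold \<Rightarrow> ('a, 'e) two_form \<Rightarrow> ('g \<Rightarrow> 'a \<Rightarrow> 'a) \<Rightarrow>
   ('a, 'z::euclidean_space) manifold \<Rightarrow>
   ('a set, 'y::euclidean_space) manifold \<Rightarrow> ('a set, 'y) two_form \<Rightarrow> bool"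
where
  "reduced_space G X \<omega> act Z Y \<omega>\<^sub>r \<longleftrightarrow>
     pts Y = orbits G (pts Z) act \<and>
     quotient_map (mtop Z) (mtop Y) (orbit G act) \<and>
     submersion Z Y (orbit G act) \<and>
     symplectic_manifold Y \<omega>\<^sub>r \<and>
     (\<forall>x\<in>pts Z. \<forall>u\<in>tangent_space Z x. \<forall>v\<in>tangent_space Z x.
        \<omega>\<^sub>r (orbit G act x) (tangent_map Z Y (orbit G act) x u) (tangent_map Z Y (orbit G act) x v) =
        \<omega> x (tangent_map Z X (\<lambda>y. y) x u) (tangent_map Z X (\<lambda>y. y) x v))"

end

theory Submission
  imports Defs
begin

text \<open>
  Let \<open>\<iota>\<close> be the inclusion of the zero level \<open>Z\<close> and \<open>\<rho>\<close> its projection to \<open>Y\<close>. The Hamiltonian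
  vector \<open>H\<^sub>f\<close> of an invariant function \<open>f\<close> is \<open>\<omega>\<close>-orthogonal to the orbits, so it annihilates the
  components of the moment map and is, by clean intersection, tangent to \<open>Z\<close>: \<open>H\<^sub>f = d\<iota> a\<close>
  (\<open>ham_vec_tangent_to_zero_level\<close>). Because \<open>\<rho>\<^sup>*\<omega>\<^sub>r = \<iota>\<^sup>*\<omega>\<close> and \<open>f' \<circ> \<rho> = f \<circ> \<iota>\<close>, the vector \<open>d\<rho> a\<close>
  satisfies the equation that defines the Hamiltonian vector of \<open>f'\<close> (\<open>ham_vec_reduced\<close>). With
  \<open>H\<^sub>g = d\<iota> b\<close>, both brackets are then the two sides of \<open>\<omega>\<^sub>r(d\<rho> a, d\<rho> b) = \<omega>(d\<iota> a, d\<iota> b)\<close>.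

  Two analytic points carry the argument. The differential of \<open>f'\<close> is meaningful only once \<open>f'\<close> is
  known to be differentiable, which follows from local sections of the submersion \<open>\<rho>\<close>
  (\<open>differentiable_descends\<close>). And the identities between differentials are instances of the chain
  rule for tangent maps (\<open>tangent_map_chain\<close>), where everything is compared on tangent spaces only.
\<close>

section \<open>Derivatives within linear subspaces\<close>

lemma at_within_relatively_open:
  fixes p :: "'e::topological_space"
  assumes "openin (top_of_set V) S" "p \<in> S"
  shows "at p within S = at p within V"
proof -
  obtain O' where O: "open O'" "S = V \<inter> O'"
    using assms(1) by (auto simp: openin_open)
  show ?thesis
    by (rule at_within_nhd[where S = O']) (use O assms(2) in auto)
qed

lemma has_vector_derivative_along_line:
  fixes f :: "'e::euclidean_space \<Rightarrow> 'f::real_normed_vector"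
  assumes "(f has_derivative D) (at p within V)" "subspace V" "p \<in> V" "v \<in> V"
  shows "((\<lambda>t. f (p + t *\<^sub>R v)) has_vector_derivative D v) (at 0)"
proof -
  have line: "((\<lambda>t. p + t *\<^sub>R v) has_derivative (\<lambda>t. t *\<^sub>R v)) (at (0::real))"
    by (auto intro!: derivative_eq_intros)
  have "range (\<lambda>t::real. p + t *\<^sub>R v) \<subseteq> V"
  proof safe
    fix t :: real
    show "p + t *\<^sub>R v \<in> V"
      by (rule subspace_add[OF assms(2,3) subspace_scale[OF assms(2,4)]])
  qed
  then have "(f has_derivative D) (at (p + 0 *\<^sub>R v) within range (\<lambda>t. p + t *\<^sub>R v))"
    using has_derivative_subset[OF assms(1)] by simp
  from has_derivative_in_compose[OF line this]
  have "((\<lambda>t. f (p + t *\<^sub>R v)) has_derivative (\<lambda>t. D (t *\<^sub>R v))) (at 0)"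
    by simp
  then show ?thesis
    using assms(1) by (simp add: has_vector_derivative_def linear_scale has_derivative_linear)
qed

text \<open>
  Within a proper subspace, Frechet derivatives are not unique as maps on the ambient space; only
  their restriction to the subspace has a meaning. This is the form of uniqueness that makes
  \<^const>\<open>tangent_map\<close>, which picks an arbitrary derivative, well defined on tangent vectors.
\<close>

lemma derivative_unique_on_subspace:
  fixes f :: "'e::euclidean_space \<Rightarrow> 'f::real_normed_vector"
  assumes "(f has_derivative D) (at p within V)" "(f has_derivative D') (at p within V)"
    and "subspace V" "p \<in> V" "v \<in> V"
  shows "D v = D' v"
  using has_vector_derivative_along_line[OF assms(1,3-5)]
    has_vector_derivative_along_line[OF assms(2,3-5)] vector_derivative_unique_at
  by blast

text \<open>
  A linear projection onto \<open>W\<close> does not change \<open>f\<close> near \<open>p\<close>, hence does not change its derivative.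
\<close>

lemma derivative_in_subspace:
  fixes f :: "'e::euclidean_space \<Rightarrow> 'f::euclidean_space"
  assumes D: "(f has_derivative D) (at p within V)"
    and S: "openin (top_of_set V) S" "p \<in> S"
    and V: "subspace V" and W: "subspace W" and fS: "f ` S \<subseteq> W" and v: "v \<in> V"
  shows "D v \<in> W"
proof -
  obtain g :: "'f \<Rightarrow> 'f" where g: "range g \<subseteq> W" "linear g" "\<And>w. w \<in> W \<Longrightarrow> g w = w"
    using linear_exists_right_inverse_on[OF linear_id W] by auto
  have DS: "(f has_derivative D) (at p within S)"
    using D by (simp add: at_within_relatively_open[OF S])
  have "((\<lambda>q. g (f q)) has_derivative (\<lambda>u. g (D u))) (at p within S)"
    by (rule bounded_linear.has_derivative[OF _ DS]) (use g(2) in \<open>simp add: linear_conv_bounded_linear\<close>)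
  then have "(f has_derivative (\<lambda>u. g (D u))) (at p within S)"
    by (rule has_derivative_transform[OF S(2), rotated]) (use g(3) fS in auto)
  then have "(f has_derivative (\<lambda>u. g (D u))) (at p within V)"
    by (simp add: at_within_relatively_open[OF S])
  moreover have "p \<in> V"
    using openin_imp_subset[OF S(1)] S(2) by blast
  ultimately have "D v = g (D v)"
    by (rule derivative_unique_on_subspace[OF D _ V _ v])
  then show ?thesis
    using g(1) by auto
qed

text \<open>
  Differentiability descends along submersions. The derivative of \<open>\<psi>\<close> at \<open>p\<close> has a linear right
  inverse \<open>R\<close>, so that \<open>w \<mapsto> \<psi> (p + R w)\<close> has the identity as its derivative on \<open>W\<close> at \<open>0\<close>. Its local
  inverse \<open>G\<close>, from the inverse function theorem, gives a differentiable local section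
  \<open>y \<mapsto> p + R (G y)\<close> of \<open>\<psi>\<close>, and \<open>k\<close> is near \<open>\<psi> p\<close> the composition of \<open>h\<close> with this section.
\<close>

lemma differentiable_descends:
  fixes \<psi> :: "'z::euclidean_space \<Rightarrow> 'y::euclidean_space" and h :: "'z \<Rightarrow> 'f::real_normed_vector"
  assumes V: "subspace V" and W: "subspace W"
    and S: "openin (top_of_set V) S" "p \<in> S"
    and \<psi>': "\<And>q. q \<in> S \<Longrightarrow> (\<psi> has_derivative \<psi>' q) (at q within S)"
    and cont: "\<And>v. v \<in> V \<Longrightarrow> continuous_on S (\<lambda>q. \<psi>' q v)"
    and \<psi>W: "\<psi> ` S \<subseteq> W" and surj: "\<psi>' p ` V = W"
    and h: "h differentiable (at p within V)"
    and k: "\<And>q. q \<in> S \<Longrightarrow> k (\<psi> q) = h q"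
  shows "k differentiable (at (\<psi> p) within W)"
proof -
  have lin: "linear (\<psi>' q)" if "q \<in> S" for q
    using \<psi>'[OF that] has_derivative_linear by blast
  obtain R where R: "range R \<subseteq> V" "linear R" "\<And>w. w \<in> W \<Longrightarrow> \<psi>' p (R w) = w"
    using linear_exists_right_inverse_on[OF lin[OF S(2)] V] surj by auto
  define P where "P = (\<lambda>w. \<psi>' p (R w))"
  have P: "linear P" "\<And>w. P w \<in> W" "\<And>w. w \<in> W \<Longrightarrow> P w = w"
    using R lin[OF S(2)] surj linear_compose[of R "\<psi>' p"] by (auto simp: P_def o_def)
  have blR: "bounded_linear R" and blP: "bounded_linear P"
    using R(2) P(1) by (simp_all add: linear_conv_bounded_linear)
  obtain O' where O: "open O'" "S = V \<inter> O'"
    using S(1) by (auto simp: openin_open)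
  have pV: "p \<in> V" using S O by auto
  define U where "U = (\<lambda>w. p + R w) -` O'"
  have contR: "continuous_on A (\<lambda>w. p + R w)" for A
    by (intro continuous_intros bounded_linear.continuous_on[OF blR])
  have US: "p + R w \<in> S \<longleftrightarrow> w \<in> U" for w
    using R(1) pV V O by (auto simp: U_def intro!: subspace_add)
  have openU: "open U"
    unfolding U_def by (intro open_vimage O contR)
  \<comment> \<open>The inverse function theorem needs a map of the whole ambient space. Since \<open>P\<close> is a projection
    onto \<open>W\<close>, adding \<open>w - P w\<close> changes nothing on \<open>W\<close> and makes the derivative at \<open>0\<close> the identity.\<close>
  define F where "F = (\<lambda>w. \<psi> (p + R w) + (w - P w))"
  define F' where "F' = (\<lambda>w. Blinfun (\<lambda>v. \<psi>' (p + R w) (R v) + (v - P v)))"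
  have F'_apply: "blinfun_apply (F' w) = (\<lambda>v. \<psi>' (p + R w) (R v) + (v - P v))" if "w \<in> U" for w
  proof -
    have "bounded_linear (\<psi>' (p + R w))"
      using US \<psi>' has_derivative_bounded_linear that by blast
    then have "bounded_linear (\<lambda>v. \<psi>' (p + R w) (R v) + (v - P v))"
      by (intro bounded_linear_add bounded_linear_sub bounded_linear_ident blP
          bounded_linear_compose[OF _ blR])
    then show ?thesis
      by (simp add: F'_def bounded_linear_Blinfun_apply)
  qed
  have derF: "(F has_derivative blinfun_apply (F' w)) (at w)" if w: "w \<in> U" for w
  proof -
    have "((\<lambda>w. p + R w) has_derivative R) (at w within U)"
      by (auto intro!: derivative_eq_intros bounded_linear_imp_has_derivative[OF blR])
    moreover have "(\<psi> has_derivative \<psi>' (p + R w)) (at (p + R w) within (\<lambda>w. p + R w) ` U)"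
      by (rule has_derivative_subset[OF \<psi>']) (use US w in auto)
    ultimately have "((\<lambda>w. \<psi> (p + R w)) has_derivative (\<lambda>v. \<psi>' (p + R w) (R v))) (at w within U)"
      by (rule has_derivative_in_compose)
    then have "((\<lambda>w. \<psi> (p + R w)) has_derivative (\<lambda>v. \<psi>' (p + R w) (R v))) (at w)"
      using at_within_open[OF w openU] by simp
    then show ?thesis
      unfolding F_def F'_apply[OF w]
      by (auto intro!: derivative_intros bounded_linear_imp_has_derivative[OF blP])
  qed
  have contF': "continuous_on U F'"
  proof (rule continuous_on_blinfun_componentwise)
    fix i :: 'y assume "i \<in> Basis"
    have "continuous_on U (\<lambda>w. \<psi>' (p + R w) (R i))"
      by (rule continuous_on_compose2[OF cont contR]) (use R(1) US in auto)
    then have "continuous_on U (\<lambda>w. \<psi>' (p + R w) (R i) + (i - P i))"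
      by (intro continuous_intros)
    then show "continuous_on U (\<lambda>w. blinfun_apply (F' w) i)"
      by (rule continuous_on_eq) (simp add: F'_apply)
  qed
  have R0: "R 0 = 0" using R(2) by (rule linear_0)
  have U0: "0 \<in> U" using US[of 0] S(2) R0 by simp
  have id: "id_blinfun o\<^sub>L F' 0 = id_blinfun"
    by (rule blinfun_eqI) (simp add: F'_apply[OF U0] R0 P_def)
  obtain U' T G G' where UT: "open U'" "U' \<subseteq> U" "0 \<in> U'" "open T" "F 0 \<in> T"
    "homeomorphism U' T F G" "\<And>y. y \<in> T \<Longrightarrow> (G has_derivative (G' y)) (at y)"
    using inverse_function_theorem[OF openU derF contF' U0 id] by metis
  have P0: "P 0 = 0" using P(1) by (rule linear_0)
  have F0: "F 0 = \<psi> p" by (simp add: F_def R0 P0)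
  have G0: "G (\<psi> p) = 0"
    using UT(3,6) F0 by (metis homeomorphism_apply1)
  have hk: "h (p + R (G y)) = k y" and GU: "G y \<in> U" if y: "y \<in> W \<inter> T" for y
  proof -
    have "G y \<in> U'" and FG: "F (G y) = y"
      using UT(6) y by (auto simp: homeomorphism_def)
    then show "G y \<in> U" using UT(2) by blast
    then have S': "p + R (G y) \<in> S" using US by blast
    \<comment> \<open>A point that \<open>F\<close> maps into \<open>W\<close> lies in \<open>W\<close> itself, so there the correction term vanishes.\<close>
    moreover have "G y - P (G y) = y - \<psi> (p + R (G y))"
      using FG by (simp add: F_def algebra_simps)
    then have "G y - P (G y) \<in> W"
      using S' \<psi>W y by (auto intro!: subspace_diff W)
    then have "P (G y - P (G y)) = G y - P (G y)"
      using P(3) by blast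
    moreover have "P (G y - P (G y)) = 0"
      using P by (simp add: linear_diff)
    ultimately have "\<psi> (p + R (G y)) = y"
      using FG by (simp add: F_def)
    then show "h (p + R (G y)) = k y"
      using k[OF S'] by simp
  qed
  have opW: "openin (top_of_set W) (W \<inter> T)"
    using UT(4) by (auto simp: openin_open)
  have \<psi>p: "\<psi> p \<in> W \<inter> T" using UT(5) F0 \<psi>W S(2) by auto
  have "(G has_derivative (G' (\<psi> p))) (at (\<psi> p) within W \<inter> T)"
    using UT(7) \<psi>p has_derivative_at_withinI by blast
  then have "((\<lambda>y. p + R (G y)) has_derivative (\<lambda>v. R (G' (\<psi> p) v))) (at (\<psi> p) within W \<inter> T)"
    by (auto intro!: derivative_eq_intros bounded_linear.has_derivative[OF blR])
  moreover obtain h' where "(h has_derivative h') (at p within V)"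
    using h by (auto simp: differentiable_def)
  then have "(h has_derivative h') (at (p + R (G (\<psi> p))) within (\<lambda>y. p + R (G y)) ` (W \<inter> T))"
    unfolding G0 R0 by (simp, elim has_derivative_subset) (use GU US O in blast)
  ultimately have "((\<lambda>y. h (p + R (G y))) has_derivative (\<lambda>v. h' (R (G' (\<psi> p) v))))
      (at (\<psi> p) within W \<inter> T)"
    by (rule has_derivative_in_compose)
  then have "(k has_derivative (\<lambda>v. h' (R (G' (\<psi> p) v)))) (at (\<psi> p) within W \<inter> T)"
    using has_derivative_transform[OF \<psi>p, of k "\<lambda>y. h (p + R (G y))"] hk by auto
  then show ?thesis
    using at_within_relatively_open[OF opW \<psi>p] by (auto simp: differentiable_def)
qed

section \<open>Nondegenerate forms\<close>

text \<open>
  In the coordinates of an orthonormal basis \<open>E\<close>, the map \<open>u \<mapsto> B u\<close> from \<open>V\<close> to its dual becomes an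
  endomorphism \<open>A\<close> of \<open>V\<close>. It is injective by nondegeneracy and hence surjective by dimension.
\<close>

lemma nondegenerate_form_represents:
  fixes V :: "'e::euclidean_space set"
  assumes V: "subspace V"
    and linl: "\<And>v. v \<in> V \<Longrightarrow> linear_functional_on V (\<lambda>u. B u v)"
    and linr: "\<And>u. u \<in> V \<Longrightarrow> linear_functional_on V (\<lambda>v. B u v)"
    and nondeg: "\<And>u. u \<in> V \<Longrightarrow> (\<And>v. v \<in> V \<Longrightarrow> B u v = 0) \<Longrightarrow> u = 0"
    and l: "linear_functional_on V l"
  shows "\<exists>!u. u \<in> V \<and> (\<forall>v\<in>V. B u v = l v)"
proof -
  obtain E where E: "E \<subseteq> V" "pairwise orthogonal E" "\<And>x. x \<in> E \<Longrightarrow> norm x = 1"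
    "independent E" "span E = V"
    using orthonormal_basis_subspace[OF V] by metis
  have finE: "finite E" using E(4) by (rule independent_imp_finite)
  have orth: "(\<Sum>b\<in>E. c b *\<^sub>R b) \<bullet> e = c e" if "e \<in> E" for c :: "'e \<Rightarrow> real" and e
  proof -
    have "(\<Sum>b\<in>E. c b *\<^sub>R b) \<bullet> e = (\<Sum>b\<in>E. if b = e then c b else 0)"
      unfolding inner_sum_left
    proof (rule sum.cong)
      fix b assume "b \<in> E"
      then show "c b *\<^sub>R b \<bullet> e = (if b = e then c b else 0)"
        using E(2,3) that by (auto simp: pairwise_def orthogonal_def dot_square_norm)
    qed simp
    then show ?thesis using finE that by simp
  qed
  have determined: "m v = m' v"
    if "linear_functional_on V m" "linear_functional_on V m'" "\<And>b. b \<in> E \<Longrightarrow> m b = m' b" "v \<in> V"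
    for m m' v
  proof -
    have "subspace {v \<in> V. m v = m' v}"
    proof (rule subspaceI)
      have "m (0 *\<^sub>R 0) = 0 * m 0" "m' (0 *\<^sub>R 0) = 0 * m' 0"
        using that(1,2) subspace_0[OF V] unfolding linear_functional_on_def by blast+
      then show "0 \<in> {v \<in> V. m v = m' v}" using subspace_0[OF V] by simp
    qed (use that(1,2) V in \<open>auto simp: linear_functional_on_def subspace_add subspace_scale\<close>)
    then have "span E \<subseteq> {v \<in> V. m v = m' v}"
      by (rule span_minimal[rotated]) (use that(3) E(1) in blast)
    then show ?thesis using E(5) that(4) by blast
  qed
  \<comment> \<open>\<open>B\<close> is linear on \<open>V\<close> only; composing with the projection \<open>\<pi>\<close> onto \<open>V\<close> makes \<open>A\<close> linear everywhere.\<close>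
  define \<pi> where "\<pi> = (\<lambda>u. \<Sum>b\<in>E. (u \<bullet> b) *\<^sub>R b)"
  have \<pi>: "linear \<pi>" "\<And>u. \<pi> u \<in> V"
    unfolding \<pi>_def using E(1) V
    by (auto intro!: linearI subspace_sum subspace_scale
        simp: inner_add_left scaleR_add_left sum.distrib scaleR_sum_right)
  have \<pi>_id: "\<pi> u = u" if "u \<in> V" for u
  proof -
    have "\<pi> u - u \<in> span E" using E(5) \<pi>(2) that V by (simp add: subspace_diff)
    moreover have "orthogonal (\<pi> u - u) e" if "e \<in> E" for e
      using orth[OF that, of "\<lambda>b. u \<bullet> b"] by (simp add: orthogonal_def \<pi>_def inner_diff_left)
    ultimately have "orthogonal (\<pi> u - u) (\<pi> u - u)"
      using orthogonal_to_span by blast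
    then show ?thesis by (simp add: orthogonal_self)
  qed
  define A where "A = (\<lambda>u. \<Sum>b\<in>E. B (\<pi> u) b *\<^sub>R b)"
  have linA: "linear A"
  proof (rule linearI)
    fix u v :: 'e and a :: real
    have "B (\<pi> (u + v)) b = B (\<pi> u) b + B (\<pi> v) b" "B (\<pi> (a *\<^sub>R u)) b = a * B (\<pi> u) b"
      if "b \<in> E" for b
      using linl[of b] that E(1) \<pi> by (auto simp: linear_functional_on_def linear_add linear_scale)
    then show "A (u + v) = A u + A v" "A (a *\<^sub>R u) = a *\<^sub>R A u"
      by (simp_all add: A_def scaleR_add_left sum.distrib scaleR_sum_right)
  qed
  have A_eq: "\<forall>v\<in>V. B u v = m v"
    if "u \<in> V" "linear_functional_on V m" "A u = (\<Sum>b\<in>E. m b *\<^sub>R b)" for u m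
  proof -
    have "B u b = m b" if b: "b \<in> E" for b
      using orth[OF b, of "\<lambda>b. B (\<pi> u) b"] orth[OF b, of m] \<open>A u = _\<close> \<pi>_id[OF \<open>u \<in> V\<close>]
      by (simp add: A_def)
    then show ?thesis using determined[OF linr that(2)] that(1) by blast
  qed
  have "inj_on A V"
  proof (subst linear_inj_on_iff_eq_0[OF linA V], intro ballI impI)
    fix u assume "u \<in> V" "A u = 0"
    then have "\<forall>v\<in>V. B u v = 0"
      using A_eq[of u "\<lambda>_. 0"] by (simp add: linear_functional_on_def)
    then show "u = 0" using nondeg \<open>u \<in> V\<close> by blast
  qed
  then have "dim (A ` V) = dim V"
    using dim_image_eq[OF linA] span_eq_iff V by metis
  moreover have "A ` V \<subseteq> V"
    unfolding A_def using E(1) V by (auto intro!: subspace_sum subspace_scale)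
  ultimately have "A ` V = V"
    by (intro subspace_dim_equal linear_subspace_image linA V) auto
  moreover have "(\<Sum>b\<in>E. l b *\<^sub>R b) \<in> V"
    using E(1) V by (auto intro!: subspace_sum subspace_scale)
  ultimately obtain u where u: "u \<in> V" "A u = (\<Sum>b\<in>E. l b *\<^sub>R b)"
    by (metis imageE)
  show ?thesis
  proof (rule ex1I[of _ u])
    show "u \<in> V \<and> (\<forall>v\<in>V. B u v = l v)" using A_eq u l by blast
    fix u' assume u': "u' \<in> V \<and> (\<forall>v\<in>V. B u' v = l v)"
    have "u' - u = 0"
    proof (rule nondeg)
      show "u' - u \<in> V" using u' u V by (simp add: subspace_diff)
      fix v assume v: "v \<in> V"
      have "B ((u' - u) + u) v = B (u' - u) v + B u v"
        using linl[OF v] \<open>u' - u \<in> V\<close> u by (simp only: linear_functional_on_def)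
      then show "B (u' - u) v = 0"
        using u' v A_eq u l by simp
    qed
    then show "u' = u" by simp
  qed
qed

section \<open>Charts and differentiability at a point\<close>

definition local_rep ::
  "('a, 'e::euclidean_space) manifold \<Rightarrow> ('b, 'f::euclidean_space) manifold \<Rightarrow> ('a \<Rightarrow> 'b) \<Rightarrow>
   'a \<Rightarrow> 'e \<Rightarrow> 'f"
where
  "local_rep M N f x = (\<lambda>p. cmap (chart_at N (f x)) (f (cinv (chart_at M x) p)))"

text \<open>
  The function induced on a quotient is defined by its values alone and is not known to be smooth.
  Pointwise differentiability in charts is all that the chain rule needs, and it can be shown to
  descend. For maps that are continuous, or into a manifold with a single chart, it is the usual
  notion of differentiability.
\<close>

definition differentiable_map_at ::
  "('a, 'e::euclidean_space) manifold \<Rightarrow> ('b, 'f::euclidean_space) manifold \<Rightarrow> ('a \<Rightarrow> 'b) \<Rightarrow> 'a \<Rightarrow> bool"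
where
  "differentiable_map_at M N f x \<longleftrightarrow>
     local_rep M N f x differentiable (at (cmap (chart_at M x) x) within tangent_space M x)"

lemma chart_at_in_atlas:
  assumes "smooth_manifold M" "x \<in> pts M"
  shows "chart_at M x \<in> atlas M" "x \<in> cdom (chart_at M x)"
proof -
  have "\<exists>c. c \<in> atlas M \<and> x \<in> cdom c"
    using assms by (auto simp: smooth_manifold_def)
  then have "chart_at M x \<in> atlas M \<and> x \<in> cdom (chart_at M x)"
    unfolding chart_at_def by (rule someI_ex)
  then show "chart_at M x \<in> atlas M" "x \<in> cdom (chart_at M x)" by auto
qed

lemma is_chart_facts:
  assumes "is_chart T c"
  shows chart_dom_open: "openin T (cdom c)" and chart_subspace: "subspace (cmodel c)"
    and chart_image_open: "openin (top_of_set (cmodel c)) (cmap c ` cdom c)"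
    and chart_inj: "inj_on (cmap c) (cdom c)"
proof -
  from assms show "openin T (cdom c)" "subspace (cmodel c)" "openin (top_of_set (cmodel c)) (cmap c ` cdom c)"
    by (auto simp: is_chart_def)
  have "homeomorphic_map (subtopology T (cdom c)) (top_of_set (cmap c ` cdom c)) (cmap c)"
    using assms by (simp add: is_chart_def)
  from homeomorphic_imp_injective_map[OF this]
  have "inj_on (cmap c) (topspace (subtopology T (cdom c)))" .
  then show "inj_on (cmap c) (cdom c)"
    using openin_subset[OF \<open>openin T (cdom c)\<close>] by (simp add: topspace_subtopology Int_absorb1)
qed

lemma chart_image_openin:
  assumes c: "is_chart T c" and U: "openin T U"
  shows "openin (top_of_set (cmodel c)) (cmap c ` (cdom c \<inter> U))"
proof -
  have "open_map (subtopology T (cdom c)) (top_of_set (cmap c ` cdom c)) (cmap c)"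
    using c unfolding is_chart_def by (blast intro: homeomorphic_imp_open_map)
  moreover have "openin (subtopology T (cdom c)) (cdom c \<inter> U)"
    using U by (auto simp: openin_subtopology)
  ultimately have "openin (top_of_set (cmap c ` cdom c)) (cmap c ` (cdom c \<inter> U))"
    unfolding open_map_def by blast
  then show ?thesis
    using openin_trans chart_image_open[OF c] by blast
qed

lemma cinv_cmap:
  assumes "is_chart T c" "y \<in> cdom c"
  shows "cinv c (cmap c y) = y"
  using chart_inj[OF assms(1)] assms(2) by (simp add: cinv_def)

lemma smooth_manifold_chart_at:
  assumes "smooth_manifold M" "x \<in> pts M"
  shows "is_chart (mtop M) (chart_at M x)"
  using assms(1) chart_at_in_atlas(1)[OF assms] by (simp add: smooth_manifold_def)

lemma subspace_tangent_space:
  assumes "smooth_manifold M" "x \<in> pts M"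
  shows "subspace (tangent_space M x)"
  using chart_subspace[OF smooth_manifold_chart_at[OF assms]] by (simp add: tangent_space_def)

lemma at_within_chart_image:
  assumes "smooth_manifold M" "x \<in> pts M"
  shows "at (cmap (chart_at M x) x) within cmap (chart_at M x) ` cdom (chart_at M x) =
    at (cmap (chart_at M x) x) within tangent_space M x"
  unfolding tangent_space_def
  using at_within_relatively_open chart_image_open[OF smooth_manifold_chart_at[OF assms]]
    chart_at_in_atlas(2)[OF assms] by blast

lemma chart_at_point_in_model:
  assumes "smooth_manifold M" "x \<in> pts M"
  shows "cmap (chart_at M x) x \<in> tangent_space M x"
  unfolding tangent_space_def
  using openin_imp_subset[OF chart_image_open[OF smooth_manifold_chart_at[OF assms]]]
    chart_at_in_atlas(2)[OF assms] by blast

lemma tangent_map_has_derivative: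
  assumes "smooth_manifold M" "x \<in> pts M" "differentiable_map_at M N f x"
  shows "(local_rep M N f x has_derivative tangent_map M N f x)
    (at (cmap (chart_at M x) x) within tangent_space M x)"
  using assms(3) unfolding differentiable_map_at_def frechet_derivative_works
  by (simp add: tangent_map_def chart_deriv_def local_rep_def at_within_chart_image[OF assms(1,2)])

lemma tangent_map_eqI:
  assumes "smooth_manifold M" "x \<in> pts M"
    and D: "(local_rep M N f x has_derivative D) (at (cmap (chart_at M x) x) within tangent_space M x)"
    and "u \<in> tangent_space M x"
  shows "tangent_map M N f x u = D u"
proof -
  have "differentiable_map_at M N f x"
    using D by (auto simp: differentiable_map_at_def differentiable_def)
  from tangent_map_has_derivative[OF assms(1,2) this] D show ?thesis
    by (rule derivative_unique_on_subspace)
      (use assms subspace_tangent_space chart_at_point_in_model in auto)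
qed

section \<open>Tangent maps\<close>

text \<open>
  The points near \<open>x\<close> on which the local representative of \<open>f\<close> really describes \<open>f\<close>: elsewhere in
  the chart domain the value of \<open>f\<close> may lie outside the chosen chart of \<open>N\<close>, where the chart map is
  arbitrary.
\<close>

lemma chart_domain_vimage_open:
  assumes M: "smooth_manifold M" and N: "smooth_manifold N"
    and f: "continuous_map (mtop M) (mtop N) f" and x: "x \<in> pts M"
  defines "S \<equiv> cmap (chart_at M x) ` (cdom (chart_at M x) \<inter> f -` cdom (chart_at N (f x)))"
  shows "openin (top_of_set (tangent_space M x)) S" "cmap (chart_at M x) x \<in> S"
proof -
  have fx: "f x \<in> pts N"
    using f x continuous_map_image_subset_topspace[OF f] by (auto simp: pts_def)
  note c = smooth_manifold_chart_at[OF M x] and d = smooth_manifold_chart_at[OF N fx]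
  have "openin (mtop M) {y \<in> topspace (mtop M). f y \<in> cdom (chart_at N (f x))}"
    using f chart_dom_open[OF d] by (rule openin_continuous_map_preimage)
  from chart_image_openin[OF c this]
  have "openin (top_of_set (cmodel (chart_at M x))) (cmap (chart_at M x) `
     (cdom (chart_at M x) \<inter> {y \<in> topspace (mtop M). f y \<in> cdom (chart_at N (f x))}))" .
  moreover have "cdom (chart_at M x) \<inter> {y \<in> topspace (mtop M). f y \<in> cdom (chart_at N (f x))}
     = cdom (chart_at M x) \<inter> f -` cdom (chart_at N (f x))"
    using openin_subset[OF chart_dom_open[OF c]] by auto
  ultimately show "openin (top_of_set (tangent_space M x)) S"
    by (simp add: S_def tangent_space_def)
  show "cmap (chart_at M x) x \<in> S"
    using chart_at_in_atlas(2)[OF M x] chart_at_in_atlas(2)[OF N fx] by (auto simp: S_def)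
qed

lemma smooth_map_local_rep_C1:
  assumes M: "smooth_manifold M" and N: "smooth_manifold N"
    and f: "smooth_map M N f" and x: "x \<in> pts M"
  defines "S \<equiv> cmap (chart_at M x) ` (cdom (chart_at M x) \<inter> f -` cdom (chart_at N (f x)))"
  obtains D where "\<And>q. q \<in> S \<Longrightarrow> (local_rep M N f x has_derivative D q) (at q within S)"
    "\<And>v. v \<in> tangent_space M x \<Longrightarrow> continuous_on S (\<lambda>q. D q v)"
proof -
  have "f x \<in> pts N"
    using x continuous_map_image_subset_topspace[of "mtop M" "mtop N" f] f by (auto simp: pts_def smooth_map_def)
  then have "smooth_on (cmodel (chart_at M x)) S (local_rep M N f x)"
    using f chart_at_in_atlas(1)[OF M x] chart_at_in_atlas(1)[OF N]
    unfolding smooth_map_def S_def local_rep_def by blast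
  then have "Ck_on (Suc 0) (cmodel (chart_at M x)) S (local_rep M N f x)"
    unfolding smooth_on_def by blast
  then show ?thesis
    using that by (auto simp: tangent_space_def)
qed

lemma smooth_map_differentiable:
  assumes M: "smooth_manifold M" and N: "smooth_manifold N"
    and f: "smooth_map M N f" and x: "x \<in> pts M"
  shows "differentiable_map_at M N f x"
proof -
  have cont: "continuous_map (mtop M) (mtop N) f" using f by (simp add: smooth_map_def)
  note S = chart_domain_vimage_open[OF M N cont x]
  obtain D where "\<And>q. q \<in> cmap (chart_at M x) ` (cdom (chart_at M x) \<inter> f -` cdom (chart_at N (f x))) \<Longrightarrow>
     (local_rep M N f x has_derivative D q)
       (at q within cmap (chart_at M x) ` (cdom (chart_at M x) \<inter> f -` cdom (chart_at N (f x))))"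
    using smooth_map_local_rep_C1[OF M N f x] by metis
  from this[OF S(2)] show ?thesis
    unfolding differentiable_map_at_def at_within_relatively_open[OF S]
    by (auto simp: differentiable_def)
qed

lemma tangent_map_in_tangent_space:
  assumes M: "smooth_manifold M" and N: "smooth_manifold N"
    and f: "continuous_map (mtop M) (mtop N) f" "differentiable_map_at M N f x" and x: "x \<in> pts M"
    and u: "u \<in> tangent_space M x"
  shows "tangent_map M N f x u \<in> tangent_space N (f x)"
proof -
  have fx: "f x \<in> pts N"
    using x continuous_map_image_subset_topspace[OF f(1)] by (auto simp: pts_def)
  have "local_rep M N f x ` cmap (chart_at M x) ` (cdom (chart_at M x) \<inter> f -` cdom (chart_at N (f x)))
    \<subseteq> cmap (chart_at N (f x)) ` cdom (chart_at N (f x))"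
    using cinv_cmap[OF smooth_manifold_chart_at[OF M x]] by (auto simp: local_rep_def)
  also have "\<dots> \<subseteq> tangent_space N (f x)"
    using openin_imp_subset[OF chart_image_open[OF smooth_manifold_chart_at[OF N fx]]]
    by (simp add: tangent_space_def)
  finally show ?thesis
    using derivative_in_subspace[OF tangent_map_has_derivative[OF M x f(2)]
      chart_domain_vimage_open[OF M N f(1) x] subspace_tangent_space[OF M x]
      subspace_tangent_space[OF N fx]] u by blast
qed

text \<open>
  The composition is required to agree with \<open>h\<close> on the points of \<open>M\<close> only, which lets \<open>h\<close> be any
  extension of it: a function given on a larger manifold, or one constant along the orbit of a point.
\<close>

lemma tangent_map_chain:
  assumes M: "smooth_manifold M" and N: "smooth_manifold N"
    and f: "continuous_map (mtop M) (mtop N) f" "differentiable_map_at M N f x"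
    and g: "differentiable_map_at N P g (f x)"
    and h: "\<And>y. y \<in> pts M \<Longrightarrow> h y = g (f y)"
    and x: "x \<in> pts M"
  shows "u \<in> tangent_space M x \<Longrightarrow>
      tangent_map M P h x u = tangent_map N P g (f x) (tangent_map M N f x u)"
    and "differentiable_map_at M P h x"
proof -
  define S where "S = cmap (chart_at M x) ` (cdom (chart_at M x) \<inter> f -` cdom (chart_at N (f x)))"
  note S = chart_domain_vimage_open[OF M N f(1) x, folded S_def]
  have fx: "f x \<in> pts N"
    using x continuous_map_image_subset_topspace[OF f(1)] by (auto simp: pts_def)
  note c = smooth_manifold_chart_at[OF M x] and d = smooth_manifold_chart_at[OF N fx]
  let ?p = "cmap (chart_at M x) x"
  have fp: "local_rep M N f x ?p = cmap (chart_at N (f x)) (f x)"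
    using cinv_cmap[OF c] chart_at_in_atlas(2)[OF M x] by (simp add: local_rep_def)
  have "local_rep M N f x ` S \<subseteq> cmap (chart_at N (f x)) ` cdom (chart_at N (f x))"
    using cinv_cmap[OF c] by (auto simp: local_rep_def S_def)
  also have "\<dots> \<subseteq> tangent_space N (f x)"
    using openin_imp_subset[OF chart_image_open[OF d]] by (simp add: tangent_space_def)
  finally have sub: "local_rep M N f x ` S \<subseteq> tangent_space N (f x)" .
  have "(local_rep M N f x has_derivative tangent_map M N f x) (at ?p within S)"
    using tangent_map_has_derivative[OF M x f(2)] by (simp add: at_within_relatively_open[OF S])
  moreover have "(local_rep N P g (f x) has_derivative tangent_map N P g (f x))
      (at (local_rep M N f x ?p) within local_rep M N f x ` S)"
    unfolding fp using tangent_map_has_derivative[OF N fx g] sub by (rule has_derivative_subset)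
  ultimately have "((\<lambda>q. local_rep N P g (f x) (local_rep M N f x q)) has_derivative
      (\<lambda>v. tangent_map N P g (f x) (tangent_map M N f x v))) (at ?p within S)"
    by (rule has_derivative_in_compose)
  then have "(local_rep M P h x has_derivative
      (\<lambda>v. tangent_map N P g (f x) (tangent_map M N f x v))) (at ?p within S)"
  proof (rule has_derivative_transform[OF S(2), rotated])
    fix q assume "q \<in> S"
    then obtain y where y: "y \<in> cdom (chart_at M x)" "f y \<in> cdom (chart_at N (f x))"
      "q = cmap (chart_at M x) y"
      by (auto simp: S_def)
    have "y \<in> pts M"
      using y(1) openin_subset[OF chart_dom_open[OF c]] by (auto simp: pts_def)
    then show "local_rep M P h x q = local_rep N P g (f x) (local_rep M N f x q)"
      using y cinv_cmap[OF c y(1)] cinv_cmap[OF d y(2)] h x by (simp add: local_rep_def)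
  qed
  then have D: "(local_rep M P h x has_derivative
      (\<lambda>v. tangent_map N P g (f x) (tangent_map M N f x v))) (at ?p within tangent_space M x)"
    by (simp add: at_within_relatively_open[OF S])
  then show "differentiable_map_at M P h x"
    by (auto simp: differentiable_map_at_def differentiable_def)
  show "tangent_map M P h x u = tangent_map N P g (f x) (tangent_map M N f x u)"
    if "u \<in> tangent_space M x"
    using tangent_map_eqI[OF M x D that] .
qed

section \<open>Real functions and submersions\<close>

lemma smooth_manifold_real: "smooth_manifold real_manifold"
proof -
  have const: "Ck_on k UNIV UNIV (\<lambda>_::real. c::real)" for k c
    by (induction k arbitrary: c) (auto intro!: exI[of _ "\<lambda>_ _. 0"])
  have "Ck_on k UNIV UNIV (\<lambda>x::real. x)" for k
    by (cases k) (auto intro!: exI[of _ "\<lambda>_ v. v"] const)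
  moreover have "cinv (Chart UNIV (\<lambda>x::real. x) UNIV) = (\<lambda>x. x)"
    by (auto simp: cinv_def inv_into_f_f[of "\<lambda>x. x", simplified])
  moreover have "second_countable (euclidean :: real topology)"
  proof -
    obtain B :: "real set set" where B: "countable B" "topological_basis B"
      using ex_countable_basis by blast
    have "\<exists>V\<in>B. x \<in> V \<and> V \<subseteq> U" if "open U" "x \<in> U" for U x
      using B(2) that by (rule topological_basisE) blast
    then show ?thesis
      using B topological_basis_open unfolding second_countable_def open_openin[symmetric] by blast
  qed
  moreover have "homeomorphic_map (euclidean :: real topology) euclidean (\<lambda>x. x)"
    using homeomorphic_map_id[unfolded id_def] by blast
  ultimately show ?thesis
    by (auto simp: smooth_manifold_def real_manifold_def is_chart_def smooth_on_def pts_def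
        Hausdorff_space_euclidean)
qed

lemma differential_linear:
  assumes "smooth_manifold M" "x \<in> pts M" "differentiable_map_at M real_manifold f x"
  shows "linear_functional_on V (differential M f x)"
  using has_derivative_linear[OF tangent_map_has_derivative[OF assms]]
  by (simp add: linear_functional_on_def linear_add linear_scale)

lemma differential_const:
  assumes M: "smooth_manifold M" "x \<in> pts M" and u: "u \<in> tangent_space M x"
  shows "differential M (\<lambda>_. c) x u = 0"
  using tangent_map_eqI[OF M _ u, of real_manifold "\<lambda>_. c" "\<lambda>_. 0"] by (simp add: local_rep_def)

text \<open>
  In charts, the continuity of the first derivative of \<open>\<rho>\<close> and the surjectivity of its tangent map at
  \<open>x\<close> are the hypotheses of \<open>differentiable_descends\<close>.
\<close>

lemma submersion_descends_differentiable:
  assumes M: "smooth_manifold M" and N: "smooth_manifold N" and \<rho>: "submersion M N \<rho>"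
    and h: "differentiable_map_at M real_manifold h x"
    and k: "\<And>y. y \<in> pts M \<Longrightarrow> k (\<rho> y) = h y"
    and x: "x \<in> pts M"
  shows "differentiable_map_at N real_manifold k (\<rho> x)"
proof -
  have sm: "smooth_map M N \<rho>" and cont: "continuous_map (mtop M) (mtop N) \<rho>"
    using \<rho> by (auto simp: submersion_def smooth_map_def)
  have \<rho>x: "\<rho> x \<in> pts N"
    using x continuous_map_image_subset_topspace[OF cont] by (auto simp: pts_def)
  define S where "S = cmap (chart_at M x) ` (cdom (chart_at M x) \<inter> \<rho> -` cdom (chart_at N (\<rho> x)))"
  note S = chart_domain_vimage_open[OF M N cont x, folded S_def]
  note c = smooth_manifold_chart_at[OF M x] and d = smooth_manifold_chart_at[OF N \<rho>x]
  let ?p = "cmap (chart_at M x) x"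
  obtain D where D: "\<And>q. q \<in> S \<Longrightarrow> (local_rep M N \<rho> x has_derivative D q) (at q within S)"
    "\<And>v. v \<in> tangent_space M x \<Longrightarrow> continuous_on S (\<lambda>q. D q v)"
    using smooth_map_local_rep_C1[OF M N sm x] unfolding S_def by metis
  have "(local_rep M N \<rho> x has_derivative D ?p) (at ?p within tangent_space M x)"
    using D(1)[OF S(2)] by (simp add: at_within_relatively_open[OF S])
  then have "tangent_map M N \<rho> x u = D ?p u" if "u \<in> tangent_space M x" for u
    using tangent_map_eqI[OF M x] that by blast
  then have "D ?p ` tangent_space M x = tangent_map M N \<rho> x ` tangent_space M x"
    by (intro image_cong) auto
  also have "\<dots> = tangent_space N (\<rho> x)"
    using \<rho> x by (auto simp: submersion_def)
  finally have surj: "D ?p ` tangent_space M x = tangent_space N (\<rho> x)" .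
  have "local_rep M N \<rho> x ` S \<subseteq> cmap (chart_at N (\<rho> x)) ` cdom (chart_at N (\<rho> x))"
    using cinv_cmap[OF c] by (auto simp: local_rep_def S_def)
  also have "\<dots> \<subseteq> tangent_space N (\<rho> x)"
    using openin_imp_subset[OF chart_image_open[OF d]] by (simp add: tangent_space_def)
  finally have sub: "local_rep M N \<rho> x ` S \<subseteq> tangent_space N (\<rho> x)" .
  have "local_rep N real_manifold k (\<rho> x) differentiable
     (at (local_rep M N \<rho> x ?p) within tangent_space N (\<rho> x))"
  proof (rule differentiable_descends[OF subspace_tangent_space[OF M x]
        subspace_tangent_space[OF N \<rho>x] S D sub surj])
    show "local_rep M real_manifold h x differentiable (at ?p within tangent_space M x)"
      using h by (simp add: differentiable_map_at_def)
    fix q assume "q \<in> S"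
    then obtain y where y: "y \<in> cdom (chart_at M x)" "\<rho> y \<in> cdom (chart_at N (\<rho> x))"
      "q = cmap (chart_at M x) y"
      by (auto simp: S_def)
    have "y \<in> pts M"
      using y(1) openin_subset[OF chart_dom_open[OF c]] by (auto simp: pts_def)
    then show "local_rep N real_manifold k (\<rho> x) (local_rep M N \<rho> x q)
        = local_rep M real_manifold h x q"
      using y cinv_cmap[OF c y(1)] cinv_cmap[OF d y(2)] k x by (simp add: local_rep_def)
  qed
  moreover have "local_rep M N \<rho> x ?p = cmap (chart_at N (\<rho> x)) (\<rho> x)"
    using cinv_cmap[OF c] chart_at_in_atlas(2)[OF M x] by (simp add: local_rep_def)
  ultimately show ?thesis
    by (simp add: differentiable_map_at_def)
qed

section \<open>Hamiltonian vectors and group actions\<close>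

text \<open>
  The orbit map is the action composed with the inclusion of the slice \<open>a \<mapsto> (a, x)\<close>, which in a product
  chart is the affine map \<open>q \<mapsto> (q, q\<^sub>0)\<close>, where \<open>q\<^sub>0\<close> is the coordinate vector of \<open>x\<close>.
\<close>

lemma orbit_map_differentiable:
  assumes GM: "smooth_manifold GM" and X: "smooth_manifold X"
    and A: "smooth_map (prod_manifold GM X) X (\<lambda>(a, x). act a x)"
    and e: "e \<in> pts GM" and x: "x \<in> pts X"
  shows "continuous_map (mtop GM) (mtop X) (\<lambda>a. act a x)"
    and "differentiable_map_at GM X (\<lambda>a. act a x) e"
proof -
  have "continuous_map (mtop GM) (prod_topology (mtop GM) (mtop X)) (\<lambda>a. (a, x))"
    using x by (auto simp: continuous_map_pairwise o_def pts_def)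
  moreover have "continuous_map (prod_topology (mtop GM) (mtop X)) (mtop X) (\<lambda>(a, x). act a x)"
    using A by (simp add: smooth_map_def prod_manifold_def)
  ultimately have "continuous_map (mtop GM) (mtop X) ((\<lambda>(a, x). act a x) \<circ> (\<lambda>a. (a, x)))"
    by (rule continuous_map_compose)
  then show cont: "continuous_map (mtop GM) (mtop X) (\<lambda>a. act a x)"
    by (simp add: o_def)
  have ex: "act e x \<in> pts X"
    using e continuous_map_image_subset_topspace[OF cont] by (auto simp: pts_def)
  define c b d where cbd: "c = chart_at GM e" "b = chart_at X x" "d = chart_at X (act e x)"
  have atl: "c \<in> atlas GM" "b \<in> atlas X" "d \<in> atlas X" and
    dom: "e \<in> cdom c" "x \<in> cdom b" "act e x \<in> cdom d"
    using chart_at_in_atlas GM X e x ex by (auto simp: cbd)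
  have c: "is_chart (mtop GM) c" and b: "is_chart (mtop X) b"
    using smooth_manifold_chart_at GM X e x by (auto simp: cbd)
  define Q where "Q = cmap (prod_chart c b) ` (cdom (prod_chart c b) \<inter> (\<lambda>(a, x). act a x) -` cdom d)"
  define S where "S = cmap c ` (cdom c \<inter> (\<lambda>a. act a x) -` cdom d)"
  have S: "openin (top_of_set (tangent_space GM e)) S" "cmap c e \<in> S"
    using chart_domain_vimage_open[OF GM X cont e] by (simp_all add: S_def cbd)
  let ?r = "\<lambda>p. cmap d ((\<lambda>(a, x). act a x) (cinv (prod_chart c b) p))"
  have "prod_chart c b \<in> atlas (prod_manifold GM X)"
    using atl by (auto simp: prod_manifold_def)
  then have "smooth_on (cmodel (prod_chart c b)) Q ?r"
    using A atl(3) unfolding smooth_map_def Q_def by blast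
  then have "Ck_on (Suc 0) (cmodel (prod_chart c b)) Q ?r"
    unfolding smooth_on_def by blast
  then obtain D where D: "\<And>p. p \<in> Q \<Longrightarrow> (?r has_derivative D p) (at p within Q)"
    by auto
  have slice: "(\<lambda>q. (q, cmap b x)) ` S \<subseteq> Q"
    using dom by (force simp: Q_def S_def prod_chart_def)
  have "((\<lambda>q. (q, cmap b x)) has_derivative (\<lambda>v. (v, 0))) (at (cmap c e) within S)"
    by (auto intro!: derivative_eq_intros)
  moreover have "(?r has_derivative D (cmap c e, cmap b x))
      (at (cmap c e, cmap b x) within (\<lambda>q. (q, cmap b x)) ` S)"
    by (rule has_derivative_subset[OF D slice]) (use slice S(2) in auto)
  ultimately have "((\<lambda>q. ?r (q, cmap b x)) has_derivative (\<lambda>v. D (cmap c e, cmap b x) (v, 0)))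
      (at (cmap c e) within S)"
    by (rule has_derivative_in_compose)
  then have "(local_rep GM X (\<lambda>a. act a x) e has_derivative (\<lambda>v. D (cmap c e, cmap b x) (v, 0)))
      (at (cmap c e) within S)"
  proof (rule has_derivative_transform[OF S(2), rotated])
    fix q assume "q \<in> S"
    then obtain a where a: "a \<in> cdom c" "q = cmap c a"
      by (auto simp: S_def)
    have "inj_on (map_prod (cmap c) (cmap b)) (cdom c \<times> cdom b)"
      using chart_inj[OF c] chart_inj[OF b] by (rule map_prod_inj_on)
    then have "cinv (prod_chart c b) (map_prod (cmap c) (cmap b) (a, x)) = (a, x)"
      using a dom by (subst cinv_def) (simp add: prod_chart_def del: map_prod_simp)
    then show "local_rep GM X (\<lambda>a. act a x) e q = ?r (q, cmap b x)"
      using a cinv_cmap[OF c a(1)] by (simp add: local_rep_def cbd)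
  qed
  then show "differentiable_map_at GM X (\<lambda>a. act a x) e"
    unfolding differentiable_map_at_def at_within_relatively_open[OF S, symmetric, folded cbd]
    by (auto simp: differentiable_def cbd at_within_relatively_open[OF S, unfolded cbd])
qed

lemma ham_vec_unique_existence:
  assumes \<omega>: "symplectic_manifold M \<omega>" and x: "x \<in> pts M"
    and f: "differentiable_map_at M real_manifold f x"
  shows "\<exists>!v. v \<in> tangent_space M x \<and> (\<forall>w\<in>tangent_space M x. \<omega> x v w = differential M f x w)"
proof -
  have M: "smooth_manifold M" using \<omega> by (simp add: symplectic_manifold_def)
  show ?thesis
    by (rule nondegenerate_form_represents[OF subspace_tangent_space[OF M x] _ _ _
        differential_linear[OF M x f]])
      (use \<omega> x in \<open>auto simp: symplectic_manifold_def smooth_two_form_def nondegenerate_two_form_def\<close>)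
qed

lemma ham_vec:
  assumes "symplectic_manifold M \<omega>" "x \<in> pts M" "differentiable_map_at M real_manifold f x"
  shows "ham_vec M \<omega> f x \<in> tangent_space M x"
    and "w \<in> tangent_space M x \<Longrightarrow> \<omega> x (ham_vec M \<omega> f x) w = differential M f x w"
  using theI'[OF ham_vec_unique_existence[OF assms], folded ham_vec_def] by auto

lemma ham_vec_eqI:
  assumes "symplectic_manifold M \<omega>" "x \<in> pts M" "differentiable_map_at M real_manifold f x"
    and "v \<in> tangent_space M x" "\<And>w. w \<in> tangent_space M x \<Longrightarrow> \<omega> x v w = differential M f x w"
  shows "ham_vec M \<omega> f x = v"
  unfolding ham_vec_def
  by (rule the1_equality[OF ham_vec_unique_existence[OF assms(1-3)]]) (use assms(4,5) in blast)

lemma two_form_antisym: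
  assumes M: "smooth_manifold M" and \<omega>: "smooth_two_form M \<omega>" and x: "x \<in> pts M"
    and u: "u \<in> tangent_space M x" and v: "v \<in> tangent_space M x"
  shows "\<omega> x u v = - \<omega> x v u"
proof -
  have uv: "u + v \<in> tangent_space M x"
    using subspace_add[OF subspace_tangent_space[OF M x] u v] .
  have lin: "linear_functional_on (tangent_space M x) (\<lambda>v. \<omega> x w v)"
    "linear_functional_on (tangent_space M x) (\<lambda>v. \<omega> x v w)" "\<omega> x w w = 0"
    if "w \<in> tangent_space M x" for w
    using \<omega> x that by (auto simp: smooth_two_form_def)
  have "0 = \<omega> x (u + v) (u + v)" using lin(3)[OF uv] by simp
  also have "\<dots> = \<omega> x (u + v) u + \<omega> x (u + v) v"
    using lin(1)[OF uv] u v by (simp only: linear_functional_on_def)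
  also have "\<omega> x (u + v) u = \<omega> x u u + \<omega> x v u"
    using lin(2)[OF u] u v by (simp only: linear_functional_on_def)
  also have "\<omega> x (u + v) v = \<omega> x u v + \<omega> x v v"
    using lin(2)[OF v] u v by (simp only: linear_functional_on_def)
  finally show ?thesis using lin(3) u v by simp
qed

text \<open>
  An invariant function is constant along the orbit map of \<open>x\<close>, whose derivative at the identity is the
  fundamental vector field at \<open>x\<close>; the chain rule then yields \<open>df(\<xi>\<^sub>X) = 0\<close>.
\<close>

lemma fund_vec_facts:
  assumes "lie_group G GM" "smooth_manifold X" "smooth_action G GM X act"
    and "x \<in> pts X" "\<xi> \<in> lie_algebra G GM"
  shows fund_vec_in_tangent_space: "fund_vec G GM X act \<xi> x \<in> tangent_space X x"
    and invariant_constant_along_fund_vec: "\<lbrakk>differentiable_map_at X real_manifold f x;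
          \<And>a. a \<in> carrier G \<Longrightarrow> f (act a x) = f x\<rbrakk>
      \<Longrightarrow> differential X f x (fund_vec G GM X act \<xi> x) = 0"
proof -
  have GM: "smooth_manifold GM" and carr: "carrier G = pts GM" and grp: "group G"
    using assms(1) by (auto simp: lie_group_def)
  have act: "group_action G (pts X) act"
    and sm: "smooth_map (prod_manifold GM X) X (\<lambda>(a, x). act a x)"
    using assms(3) by (auto simp: smooth_action_def)
  have e: "\<one>\<^bsub>G\<^esub> \<in> pts GM"
    using grp carr group.is_monoid monoid.one_closed by metis
  have act1: "act \<one>\<^bsub>G\<^esub> x = x"
    using group_action.id_eq_one[OF act] assms(4) by (metis restrict_apply')
  note orb = orbit_map_differentiable[OF GM assms(2) sm e assms(4)]
  show "fund_vec G GM X act \<xi> x \<in> tangent_space X x"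
    using tangent_map_in_tangent_space[OF GM assms(2) orb e] assms(5) act1
    by (simp add: fund_vec_def lie_algebra_def)
  assume f: "differentiable_map_at X real_manifold f x"
    and inv: "\<And>a. a \<in> carrier G \<Longrightarrow> f (act a x) = f x"
  have "differential X f x (fund_vec G GM X act \<xi> x) = differential GM (\<lambda>_. f x) \<one>\<^bsub>G\<^esub> \<xi>"
    using tangent_map_chain(1)[OF GM assms(2) orb, of real_manifold f "\<lambda>_. f x"] f inv carr e
      assms(5) act1
    by (simp add: fund_vec_def lie_algebra_def)
  also have "\<dots> = 0"
    using differential_const[OF GM e] assms(5) by (simp add: lie_algebra_def)
  finally show "differential X f x (fund_vec G GM X act \<xi> x) = 0" .
qed

section \<open>Reduction\<close>

text \<open>
  The moment map is conserved by the Hamiltonian flow of an invariant function: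
  \<open>d\<Phi>\<^sub>\<xi>(H\<^sub>f) = \<omega>(\<xi>\<^sub>X, H\<^sub>f) = - df(\<xi>\<^sub>X) = 0\<close>. So \<open>H\<^sub>f\<close> lies in the kernel of \<open>d\<Phi>\<close>, and clean
  intersection says that this kernel is tangent to the zero level.
\<close>

lemma ham_vec_tangent_to_zero_level:
  assumes G: "lie_group G GM" and X: "symplectic_manifold X \<omega>"
    and ham: "hamiltonian_action G GM X \<omega> act \<Phi>"
    and Z: "clean_zero_level X (lie_algebra G GM) \<Phi> Z"
    and f: "smooth_map X real_manifold f"
    and inv: "\<And>a x. a \<in> carrier G \<Longrightarrow> x \<in> pts X \<Longrightarrow> f (act a x) = f x"
    and x: "x \<in> pts Z"
  shows "ham_vec X \<omega> f x \<in> tangent_map Z X (\<lambda>y. y) x ` tangent_space Z x"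
proof -
  have XM: "smooth_manifold X" and form: "smooth_two_form X \<omega>"
    using X by (auto simp: symplectic_manifold_def)
  have xX: "x \<in> pts X" using Z x by (auto simp: clean_zero_level_def embedded_submanifold_def)
  have act: "smooth_action G GM X act" using ham by (simp add: hamiltonian_action_def)
  note df = smooth_map_differentiable[OF XM smooth_manifold_real f xX]
  note H = ham_vec[OF X xX df]
  have "differential X (\<lambda>y. \<Phi> y \<xi>) x (ham_vec X \<omega> f x) = 0" if \<xi>: "\<xi> \<in> lie_algebra G GM" for \<xi>
  proof -
    note \<xi>X = fund_vec_in_tangent_space[OF G XM act xX \<xi>]
    have "differential X (\<lambda>y. \<Phi> y \<xi>) x (ham_vec X \<omega> f x) =
        \<omega> x (fund_vec G GM X act \<xi> x) (ham_vec X \<omega> f x)"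
      using ham \<xi> xX H(1) by (simp add: hamiltonian_action_def)
    also have "\<dots> = - \<omega> x (ham_vec X \<omega> f x) (fund_vec G GM X act \<xi> x)"
      using two_form_antisym[OF XM form xX \<xi>X H(1)] .
    also have "\<dots> = - differential X f x (fund_vec G GM X act \<xi> x)"
      using H(2)[OF \<xi>X] by simp
    also have "\<dots> = 0"
      using invariant_constant_along_fund_vec[OF G XM act xX \<xi> df] inv xX by simp
    finally show ?thesis .
  qed
  then show ?thesis
    using Z x H(1) by (auto simp: clean_zero_level_def dual_deriv_def)
qed

text \<open>
  For a vector \<open>a\<close> tangent to the zero level that represents \<open>H\<^sub>f\<close>, and any tangent vector \<open>c\<close>,
  \<open>\<omega>\<^sub>r(d\<rho> a, d\<rho> c) = \<omega>(H\<^sub>f, d\<iota> c) = df(d\<iota> c) = df'(d\<rho> c)\<close>. Since \<open>d\<rho>\<close> is surjective, this is the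
  equation that characterizes the Hamiltonian vector of \<open>f'\<close>.
\<close>

lemma ham_vec_reduced:
  assumes G: "lie_group G GM" and X: "symplectic_manifold X \<omega>"
    and ham: "hamiltonian_action G GM X \<omega> act \<Phi>"
    and Z: "clean_zero_level X (lie_algebra G GM) \<Phi> Z"
    and Y: "reduced_space G X \<omega> act Z Y \<omega>\<^sub>r"
    and f: "smooth_map X real_manifold f"
    and inv: "\<And>a x. a \<in> carrier G \<Longrightarrow> x \<in> pts X \<Longrightarrow> f (act a x) = f x"
    and f': "\<And>x. x \<in> pts Z \<Longrightarrow> f' (orbit G act x) = f x"
    and x: "x \<in> pts Z"
  obtains a where "a \<in> tangent_space Z x" "ham_vec X \<omega> f x = tangent_map Z X (\<lambda>y. y) x a"
    "ham_vec Y \<omega>\<^sub>r f' (orbit G act x) = tangent_map Z Y (orbit G act) x a"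
proof -
  let ?\<iota> = "tangent_map Z X (\<lambda>y. y) x" and ?\<rho> = "tangent_map Z Y (orbit G act) x"
  have XM: "smooth_manifold X" and YM: "smooth_manifold Y" and ZM: "smooth_manifold Z"
    and xX: "x \<in> pts X" and \<iota>: "smooth_map Z X (\<lambda>y. y)"
    and \<rho>: "submersion Z Y (orbit G act)" and Ysymp: "symplectic_manifold Y \<omega>\<^sub>r"
    using X Y Z x by (auto simp: symplectic_manifold_def reduced_space_def clean_zero_level_def
        embedded_submanifold_def)
  have \<rho>_smooth: "smooth_map Z Y (orbit G act)" using \<rho> by (simp add: submersion_def)
  have cont: "continuous_map (mtop Z) (mtop X) (\<lambda>y. y)" "continuous_map (mtop Z) (mtop Y) (orbit G act)"
    using \<iota> \<rho>_smooth by (auto simp: smooth_map_def)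
  have surj: "?\<rho> ` tangent_space Z x = tangent_space Y (orbit G act x)"
    using \<rho> x by (simp add: submersion_def)
  have \<iota>_mem: "?\<iota> c \<in> tangent_space X x" if "c \<in> tangent_space Z x" for c
    using tangent_map_in_tangent_space[OF ZM XM cont(1) smooth_map_differentiable[OF ZM XM \<iota> x] x that] .
  have yY: "orbit G act x \<in> pts Y"
    using x continuous_map_image_subset_topspace[OF cont(2)] by (auto simp: pts_def)
  note df = smooth_map_differentiable[OF XM smooth_manifold_real f xX]
  note d\<iota> = smooth_map_differentiable[OF ZM XM \<iota> x]
    and d\<rho> = smooth_map_differentiable[OF ZM YM \<rho>_smooth x]
  have dfZ: "differentiable_map_at Z real_manifold f x"
    by (rule tangent_map_chain(2)[OF ZM XM cont(1) d\<iota> df _ x]) simp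
  have f\<iota>: "differential Z f x c = differential X f x (?\<iota> c)" if "c \<in> tangent_space Z x" for c
    by (rule tangent_map_chain(1)[OF ZM XM cont(1) d\<iota> df _ x that]) simp
  have df': "differentiable_map_at Y real_manifold f' (orbit G act x)"
    by (rule submersion_descends_differentiable[OF ZM YM \<rho> dfZ _ x]) (rule f')
  have f'\<rho>: "differential Z f x c = differential Y f' (orbit G act x) (?\<rho> c)"
    if "c \<in> tangent_space Z x" for c
    by (rule tangent_map_chain(1)[OF ZM YM cont(2) d\<rho> df' _ x that]) (simp add: f')
  note H = ham_vec[OF X xX df]
  have "ham_vec X \<omega> f x \<in> ?\<iota> ` tangent_space Z x"
    by (rule ham_vec_tangent_to_zero_level[OF G X ham Z f _ x]) (rule inv)
  then obtain a where a: "a \<in> tangent_space Z x" "ham_vec X \<omega> f x = ?\<iota> a"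
    by blast
  have "ham_vec Y \<omega>\<^sub>r f' (orbit G act x) = ?\<rho> a"
  proof (rule ham_vec_eqI[OF Ysymp yY df'])
    show "?\<rho> a \<in> tangent_space Y (orbit G act x)"
      using surj a(1) by auto
    fix w assume "w \<in> tangent_space Y (orbit G act x)"
    then obtain c where c: "c \<in> tangent_space Z x" "w = ?\<rho> c"
      using surj by auto
    have "\<omega>\<^sub>r (orbit G act x) (?\<rho> a) w = \<omega> x (?\<iota> a) (?\<iota> c)"
      using Y x a c by (simp add: reduced_space_def)
    also have "\<dots> = differential X f x (?\<iota> c)"
      using H(2)[OF \<iota>_mem[OF c(1)]] a(2) by simp
    also have "\<dots> = differential Y f' (orbit G act x) w"
      using f\<iota>[OF c(1)] f'\<rho>[OF c(1)] c(2) by simp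
    finally show "\<omega>\<^sub>r (orbit G act x) (?\<rho> a) w = differential Y f' (orbit G act x) w" .
  qed
  with a show thesis by (rule that)
qed

theorem lemma3p4:
  fixes G :: "'g monoid"
    and GM :: "('g, 'l::euclidean_space) manifold"
    and X :: "('a, 'e::euclidean_space) manifold"
    and \<omega> :: "('a, 'e) two_form"
    and act :: "'g \<Rightarrow> 'a \<Rightarrow> 'a"
    and \<Phi> :: "'a \<Rightarrow> 'l \<Rightarrow> real"
    and Z :: "('a, 'z::euclidean_space) manifold"
    and Y :: "('a set, 'y::euclidean_space) manifold"
    and \<omega>\<^sub>r :: "('a set, 'y) two_form"
    and f g :: "'a \<Rightarrow> real"
    and f' g' :: "'a set \<Rightarrow> real"
  assumes "lie_group G GM"
    and "symplectic_manifold X \<omega>"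
    and "hamiltonian_action G GM X \<omega> act \<Phi>"
    and "clean_zero_level X (lie_algebra G GM) \<Phi> Z"
    and "reduced_space G X \<omega> act Z Y \<omega>\<^sub>r"
    and "smooth_map X real_manifold f"
    and "smooth_map X real_manifold g"
    and "\<And>a x. a \<in> carrier G \<Longrightarrow> x \<in> pts X \<Longrightarrow> f (act a x) = f x"
    and "\<And>a x. a \<in> carrier G \<Longrightarrow> x \<in> pts X \<Longrightarrow> g (act a x) = g x"
    and "\<And>x. x \<in> pts Z \<Longrightarrow> f' (orbit G act x) = f x"
    and "\<And>x. x \<in> pts Z \<Longrightarrow> g' (orbit G act x) = g x"
  shows "(\<forall>x\<in>pts Z. poisson Y \<omega>\<^sub>r f' g' (orbit G act x) = poisson X \<omega> f g x) \<and>
         ((\<forall>x\<in>pts X. poisson X \<omega> f g x = 0) \<longrightarrow> (\<forall>y\<in>pts Y. poisson Y \<omega>\<^sub>r f' g' y = 0))"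
proof -
  have bracket: "poisson Y \<omega>\<^sub>r f' g' (orbit G act x) = poisson X \<omega> f g x" if x: "x \<in> pts Z" for x
  proof -
    obtain a where a: "a \<in> tangent_space Z x" "ham_vec X \<omega> f x = tangent_map Z X (\<lambda>y. y) x a"
      "ham_vec Y \<omega>\<^sub>r f' (orbit G act x) = tangent_map Z Y (orbit G act) x a"
      using ham_vec_reduced[where f = f and f' = f', OF assms(1-6) _ _ x] assms(8,10) by metis
    obtain b where b: "b \<in> tangent_space Z x" "ham_vec X \<omega> g x = tangent_map Z X (\<lambda>y. y) x b"
      "ham_vec Y \<omega>\<^sub>r g' (orbit G act x) = tangent_map Z Y (orbit G act) x b"
      using ham_vec_reduced[where f = g and f' = g', OF assms(1-5,7) _ _ x] assms(9,11) by metis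
    show ?thesis
      using assms(5) x a b by (simp add: poisson_def reduced_space_def)
  qed
  moreover have "\<exists>x\<in>pts Z. y = orbit G act x" if "y \<in> pts Y" for y
  proof -
    have "pts Y = orbits G (pts Z) act"
      using assms(5) by (simp add: reduced_space_def)
    then show ?thesis
      using that by (auto simp: orbits_def)
  qed
  moreover have "pts Z \<subseteq> pts X"
    using assms(4) by (auto simp: clean_zero_level_def embedded_submanifold_def)
  ultimately show ?thesis by (metis subsetD)
qed

end
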